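(* Let $R$ be a commutative Bezout domain of Gelfand range 1. Then $R$ is an elementary divisor ring.
   Context: All rings are commutative with identity. A ring is a Bezout ring if every finitely generated ideal is principal. An element $a$ of a commutative ring $R$ is called a Gelfand element if for all $b, c \in R$ with $bR + cR + aR = R$ there exist $r, s \in R$ such that $a = rs$, $rR + bR = R$ and $sR + cR = R$. A commutative Bezout domain $R$ is a ring of Gelfand range 1 if for any $a, b \in R$ with $aR + bR = R$ there exists $t \in R$ such that $a + bt$ is a Gelfand element. A ring $R$ is an elementary divisor ring if for every (rectangular) matrix $A$ over $R$ there exist invertible matrices $P, Q$ over $R$ of appropriate sizes such that $PAQ$ is a diagonal matrix with diagonal entries $d_1, d_2, \dots$ satisfying $d_i \mid d_{i+1}$ for all $i$. *)

theory Defs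
  imports "Jordan_Normal_Form.Matrix" "HOL-Library.Set_Algebras"
begin

(* The qualified name is the type-class based module locale; HOL-Algebra also has a
   record based one. Over the scalar multiplication of R itself, spans are the
   ideals generated by sets. *)
abbreviation ideal_generated :: "'a::comm_ring_1 set \<Rightarrow> 'a set" where
  "ideal_generated S \<equiv> Modules.module.span (*) S"

abbreviation principal_ideal :: "'a::comm_ring_1 \<Rightarrow> 'a set" where
  "principal_ideal a \<equiv> range ((*) a)"

definition bezout_ring :: "'a::comm_ring_1 itself \<Rightarrow> bool" where
  "bezout_ring TYPE('a) \<longleftrightarrow>
     (\<forall>S :: 'a set. finite S \<longrightarrow> (\<exists>d. ideal_generated S = principal_ideal d))"

(* Addition of sets is elementwise, so these are sums of ideals. *)
definition gelfand_element :: "'a::comm_ring_1 \<Rightarrow> bool" where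
  "gelfand_element a \<longleftrightarrow>
     (\<forall>b c. principal_ideal b + principal_ideal c + principal_ideal a = UNIV \<longrightarrow>
        (\<exists>r s. a = r * s \<and> principal_ideal r + principal_ideal b = UNIV \<and> principal_ideal s + principal_ideal c = UNIV))"

definition gelfand_range_1 :: "'a::idom itself \<Rightarrow> bool" where
  "gelfand_range_1 TYPE('a) \<longleftrightarrow>
     (\<forall>a b :: 'a. principal_ideal a + principal_ideal b = UNIV \<longrightarrow> (\<exists>t. gelfand_element (a + b * t)))"

(* A ranges over matrices of all sizes; the last condition is only about diagonal positions
   that exist, since matrix entries outside the dimensions are unspecified. *)
definition elementary_divisor_ring :: "'a::comm_ring_1 itself \<Rightarrow> bool" where
  "elementary_divisor_ring TYPE('a) \<longleftrightarrow>
     (\<forall>A :: 'a mat. \<exists>P Q D.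
        P \<in> carrier_mat (dim_row A) (dim_row A) \<and> invertible_mat P \<and>
        Q \<in> carrier_mat (dim_col A) (dim_col A) \<and> invertible_mat Q \<and>
        D = P * A * Q \<and> diagonal_mat D \<and>
        (\<forall>i. i + 1 < min (dim_row A) (dim_col A) \<longrightarrow> D $$ (i, i) dvd D $$ (i + 1, i + 1)))"

end

theory Submission
  imports Defs
begin

text \<open>Following Kaplansky, diagonal reduction rests on one condition on coprime triples: if $a, b, c$
generate the unit ideal, then there are $x, y$ with $y$ coprime to both $x$ and $a$ such that
$xa + yb$ is coprime to $c$. The Gelfand hypothesis gives this condition as follows. From
$x_0 a + y_0 b + wc = 1$ one sees that $y_0$ is coprime to $g = \gcd(a, c)$, so some
$y = y_0 + gl$ is a Gelfand element. As $gl$ is a combination of $a$ and $c$, the correction of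
$y_0$ can be absorbed into $x_0$ and $w$; this leaves $xa + yb \equiv 1$ modulo $c$. Since
$a, c, y$ generate the unit ideal, $y = uv$ with $u$ coprime to $a$ and $v$ coprime to $c$.
Modulo $c$ the factor $v$ is invertible and can be divided out of $xa + uvb$, which puts the
divisor $u$ of $y$, coprime to $a$, in the place of $y$. Cancelling the common
factor of the two new coefficients makes them coprime (\<open>kaplansky_condition\<close>).

The passage to matrices avoids ascending chains, which need not stop in a Bezout domain. The
condition says that the entries of a triangular $2 \times 2$ matrix have a greatest common divisor
of the form $p^T A q$ (\<open>two_by_two_gcd_value\<close>). Induction on the number of rows extends this to
every $A$ (\<open>gcd_as_bilinear_value\<close>): the rows below the new one contribute a greatest common
divisor $d = p^T A q$ and a functional $w$ with $p^T A = dw$ and $wq = 1$; splitting the column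
space as $\langle q \rangle \oplus \ker w$ leaves only a triangular $2 \times 2$ problem.

If $A = g A_1$ with $g = p^T A q \neq 0$, then $p^T A_1 q = 1$. So $p$ is dual to $A_1 q$ and $q$
is dual to $A_1^T p$, and both dual pairs extend to invertible matrices
(\<open>dual_pair_completion\<close>). The change of bases with these matrices turns $A_1$
into a block matrix $1 \oplus A'$ in a single step (\<open>split_off_gcd\<close>). Thus
$A$ is equivalent to $g \oplus g A'$, and a diagonal reduction of the smaller $A'$ finishes the
argument; the factor $g$ in the second block yields the divisibility of the diagonal entries.\<close>

section \<open>Comaximal elements and Bezout domains\<close>

definition comaximal :: "'a::comm_ring_1 \<Rightarrow> 'a \<Rightarrow> bool" where
  "comaximal a b \<longleftrightarrow> (\<exists>x y. x * a + y * b = 1)"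

lemma comaximal_commute: "comaximal a b \<longleftrightarrow> comaximal b a"
  unfolding comaximal_def by (metis add.commute)

lemma comaximal_iff_ideals: "comaximal a b \<longleftrightarrow> principal_ideal a + principal_ideal b = UNIV"
proof
  assume "comaximal a b"
  then obtain x y where "x * a + y * b = 1" by (auto simp: comaximal_def)
  then have "z = a * (x * z) + b * (y * z)" for z
    by (metis (no_types, lifting) distrib_right mult.assoc mult.commute mult_1)
  then show "principal_ideal a + principal_ideal b = UNIV"
    by (auto simp: set_plus_def)
next
  assume "principal_ideal a + principal_ideal b = UNIV"
  then have "1 \<in> principal_ideal a + principal_ideal b" by simp
  then show "comaximal a b" 
    by (auto simp: set_plus_def comaximal_def) (metis mult.commute)
qed

lemma three_ideals_UNIV:
  assumes "x * a + y * b + z * (c::'a::comm_ring_1) = 1"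
  shows "principal_ideal a + principal_ideal b + principal_ideal c = UNIV"
proof -
  have "t = a * (x * t) + b * (y * t) + c * (z * t)" for t
  proof -
    have "t = (x * a + y * b + z * c) * t" using assms by simp
    then show ?thesis by (simp add: algebra_simps)
  qed
  then show ?thesis by (auto simp: set_plus_def)
qed

lemma comaximal_dvd:
  assumes "comaximal a b" "a' dvd a" shows "comaximal a' b"
proof -
  obtain x y k where "x * a + y * b = 1" "a = a' * k"
    using assms by (auto simp: comaximal_def dvd_def)
  then have "(x * k) * a' + y * b = 1" by (simp add: mult_ac)
  then show ?thesis unfolding comaximal_def by blast
qed

lemma comaximal_mult:
  assumes "comaximal a b" "comaximal a c" shows "comaximal a (b * c)"
proof -
  obtain x y x' y' where *: "x * a + y * b = 1" "x' * a + y' * c = 1"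
    using assms by (auto simp: comaximal_def)
  have "(x * (x' * a + y' * c) + y * b * x') * a + (y * y') * (b * c) 
     = (x * a + y * b) * (x' * a + y' * c)" by (simp add: algebra_simps)
  then show ?thesis using * unfolding comaximal_def by (intro exI[of _ "x * (x' * a + y' * c) + y * b * x'"] exI[of _ "y * y'"]) simp
qed

lemma bezout_pair:
  assumes "bezout_ring TYPE('a::idom)"
  shows "\<exists>s t. s * a + t * b dvd a \<and> s * a + t * (b::'a) dvd b"
proof -
  interpret Modules.module "(*) :: 'a \<Rightarrow> 'a \<Rightarrow> 'a"
    by standard (simp_all add: algebra_simps)
  obtain d where d: "ideal_generated {a, b} = principal_ideal d"
    using assms unfolding bezout_ring_def by (meson finite.emptyI finite.insertI)
  have "d \<in> span {a, b}" unfolding d by (auto intro: range_eqI[of _ _ 1])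
  then obtain s t where "d = s * a + t * b"
    by (auto simp: span_breakdown_eq algebra_simps)
  moreover have "a \<in> principal_ideal d" "b \<in> principal_ideal d"
    unfolding d[symmetric] by (auto intro: span_base)
  ultimately show ?thesis by (metis dvd_triv_left imageE)
qed

text \<open>The Hermite property. Dividing a Bezout combination by itself shows that the quotients are
comaximal; when both elements vanish, the pair $(1, 0)$ serves.\<close>

lemma hermite_pair:
  fixes a b :: "'a::idom"
  assumes "bezout_ring TYPE('a)"
  obtains g a' b' where "a = g * a'" "b = g * b'" "comaximal a' b'"
proof -
  obtain s t where st: "s * a + t * b dvd a" "s * a + t * b dvd b"
    using bezout_pair[OF assms] by blast
  define g where "g = s * a + t * b"
  obtain a' b' where ab: "a = g * a'" "b = g * b'" using st unfolding g_def dvd_def by metis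
  show thesis
  proof (cases "g = 0")
    case True
    then have "a = g * 1" "b = g * 0" using ab by simp_all
    moreover have "comaximal (1::'a) 0" unfolding comaximal_def by (intro exI[of _ 1]) simp
    ultimately show thesis by (rule that)
  next
    case False
    have "g * (s * a' + t * b') = s * (g * a') + t * (g * b')" by (simp add: algebra_simps)
    also have "\<dots> = g * 1" unfolding ab[symmetric] by (simp add: g_def)
    finally have "g * (s * a' + t * b') = g * 1" .
    then have "s * a' + t * b' = 1" using False mult_left_cancel by blast
    then have "comaximal a' b'" unfolding comaximal_def by blast
    with ab show thesis by (rule that)
  qed
qed

section \<open>Kaplansky's condition from Gelfand range 1\<close>

text \<open>The Gelfand element is a modification of the coefficient $y_0$ of $b$, not of an entry of the
triple. Changing $y_0$ by a multiple of $\gcd(a, c)$ can be undone, up to multiples of $c$, by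
changing $x_0$, and $y_0$ is coprime to $\gcd(a, c)$, as the range condition demands.\<close>

lemma kaplansky_condition:
  fixes a b c :: "'a::idom"
  assumes B: "bezout_ring TYPE('a)" and G: "gelfand_range_1 TYPE('a)"
    and unimod: "x0 * a + y0 * b + w * c = 1"
  shows "\<exists>x y. comaximal y x \<and> comaximal y a \<and> comaximal (x * a + y * b) c"
proof -
  obtain s t where st: "s * a + t * c dvd a" "s * a + t * c dvd c"
    using bezout_pair[OF B] by blast
  define g where "g = s * a + t * c"
  obtain a' c' where ac: "a = g * a'" "c = g * c'" using st unfolding g_def dvd_def by metis
  have "b * y0 + (x0 * a' + w * c') * g = 1"
    using unimod ac by (simp add: algebra_simps)
  then have "principal_ideal y0 + principal_ideal g = UNIV"
    unfolding comaximal_iff_ideals[symmetric] comaximal_def by blast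
  then obtain l where l: "gelfand_element (y0 + g * l)"
    using G unfolding gelfand_range_1_def by blast
  define y where "y = y0 + g * l"
  define k where "k = x0 * a' + w * c' - l * b"
  have "(k * s) * a + (k * t) * c + b * y = k * g + b * y"
    by (simp add: g_def algebra_simps)
  also have "\<dots> = x0 * (g * a') + y0 * b + w * (g * c')"
    by (simp add: k_def y_def algebra_simps)
  also have "\<dots> = 1" using unimod ac by simp
  finally have "principal_ideal a + principal_ideal c + principal_ideal y = UNIV"
    by (rule three_ideals_UNIV)
  then obtain u v where uv: "y = u * v" "comaximal u a" "comaximal v c"
    using l unfolding gelfand_element_def y_def[symmetric] comaximal_iff_ideals by blast
  \<comment> \<open>Since \<open>g * l = s * l * a + t * l * c\<close>, this compensates the change of \<open>y0\<close> modulo \<open>c\<close>.\<close>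
  define x where "x = x0 - s * l * b"
  have xy: "x * a + y * b = 1 + (t * l * b - w) * c"
  proof -
    have "x * a + y * b = (x0 * a + y0 * b + w * c) + (t * l * b - w) * c"
      by (simp add: x_def y_def g_def algebra_simps)
    then show ?thesis using unimod by simp
  qed
  obtain v' m where vm: "v' * v + m * c = 1" using uv(3) by (auto simp: comaximal_def)
  \<comment> \<open>With \<open>v'\<close> inverse to \<open>v\<close> modulo \<open>c\<close>, the next element is congruent to \<open>v' * (x * a + y * b)\<close>.\<close>
  have "comaximal (x * v' * a + u * b) c"
  proof -
    have "v * (x * v' * a + u * b) = x * a * (v' * v + m * c) - x * a * m * c + y * b"
      using uv(1) by (simp add: algebra_simps)
    also have "\<dots> = (x * a + y * b) - x * a * m * c" using vm by simp
    also have "\<dots> = 1 + (t * l * b - w - x * a * m) * c" unfolding xy by (simp add: algebra_simps)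
    finally have "v * (x * v' * a + u * b) + (- (t * l * b - w - x * a * m)) * c = 1"
      by (simp add: algebra_simps)
    then show ?thesis unfolding comaximal_def by blast
  qed
  \<comment> \<open>The coefficients \<open>x * v'\<close> and \<open>u\<close> may share a factor \<open>h\<close>; it divides a unit modulo \<open>c\<close>
    and can be cancelled, and \<open>u2\<close> stays coprime to \<open>a\<close> as a divisor of \<open>u\<close>.\<close>
  moreover obtain h x2 u2 where h: "x * v' = h * x2" "u = h * u2" "comaximal x2 u2"
    by (rule hermite_pair[OF B])
  moreover have "x2 * a + u2 * b dvd h * x2 * a + h * u2 * b"
    by (metis distrib_left dvd_triv_right mult.assoc)
  ultimately have "comaximal (x2 * a + u2 * b) c" using comaximal_dvd by metis
  moreover have "comaximal u2 a" using uv(2) h(2) comaximal_dvd dvd_triv_right by metis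
  ultimately show ?thesis using h(3) comaximal_commute[of u2 x2] by blast
qed

section \<open>Greatest common divisors of matrices as bilinear values\<close>

text \<open>The value of the bilinear form of the matrix with rows $(e, f)$ and $(d, 0)$ at the vectors
$(x, y)$ and $(\alpha, \beta)$ is $(xe + yd)\alpha + xf\beta$. After division by the greatest
common divisor, it can be made $1$ exactly when $xe + yd$ and $xf$ are comaximal, and Kaplansky's
condition for $(d, e, f)$ provides such $x$ and $y$.\<close>

lemma two_by_two_gcd_value:
  fixes e f d :: "'a::idom"
  assumes B: "bezout_ring TYPE('a)" and G: "gelfand_range_1 TYPE('a)"
  obtains x y \<alpha> \<beta> g where "g = x * e * \<alpha> + x * f * \<beta> + y * d * \<alpha>"
    and "g dvd e" and "g dvd f" and "g dvd d"
proof -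
  obtain h d0 e0 where h: "d = h * d0" "e = h * e0" "comaximal d0 e0"
    by (rule hermite_pair[OF B])
  obtain g h1 f1 where g: "h = g * h1" "f = g * f1" "comaximal h1 f1"
    by (rule hermite_pair[OF B])
  obtain k l where kl: "k * d0 + l * e0 = 1" using h(3) by (auto simp: comaximal_def)
  obtain k' l' where kl': "k' * h1 + l' * f1 = 1" using g(3) by (auto simp: comaximal_def)
  have "(k' * k) * (h1 * d0) + (k' * l) * (h1 * e0) + l' * f1
      = k' * h1 * (k * d0 + l * e0) + l' * f1" by (simp add: algebra_simps)
  then have "(k' * k) * (h1 * d0) + (k' * l) * (h1 * e0) + l' * f1 = 1" using kl kl' by simp
  from kaplansky_condition[OF B G this] obtain y x where
    xy: "comaximal x y" "comaximal x (h1 * d0)" "comaximal (y * (h1 * d0) + x * (h1 * e0)) f1"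
    by blast
  have "comaximal x (y * (h1 * d0))" using xy comaximal_mult by blast
  then obtain i j where "i * x + j * (y * (h1 * d0)) = 1" by (auto simp: comaximal_def)
  then have "j * (y * (h1 * d0) + x * (h1 * e0)) + (i - j * (h1 * e0)) * x = 1"
    by (simp add: algebra_simps)
  then have "comaximal (y * (h1 * d0) + x * (h1 * e0)) x" unfolding comaximal_def by blast
  then have "comaximal (y * (h1 * d0) + x * (h1 * e0)) (x * f1)"
    using xy(3) comaximal_mult by blast
  then obtain \<alpha> \<beta> where ab: "\<alpha> * (y * (h1 * d0) + x * (h1 * e0)) + \<beta> * (x * f1) = 1"
    by (auto simp: comaximal_def)
  have "x * e * \<alpha> + x * f * \<beta> + y * d * \<alpha>
     = g * (\<alpha> * (y * (h1 * d0) + x * (h1 * e0)) + \<beta> * (x * f1))"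
    unfolding h g by (simp add: algebra_simps)
  then have "g = x * e * \<alpha> + x * f * \<beta> + y * d * \<alpha>" using ab by simp
  moreover have "g dvd e" "g dvd f" "g dvd d" unfolding h g by auto
  ultimately show thesis by (rule that)
qed

lemma bezout_row:
  fixes r :: "nat \<Rightarrow> 'a::idom"
  assumes B: "bezout_ring TYPE('a)"
  shows "\<exists>z. \<forall>j<n. (\<Sum>j<n. r j * z j) dvd r j"
proof (induction n)
  case 0
  show ?case by simp
next
  case (Suc n)
  then obtain z where z: "\<forall>j<n. (\<Sum>j<n. r j * z j) dvd r j" ..
  define h where "h = (\<Sum>j<n. r j * z j)"
  obtain s t where st: "s * h + t * r n dvd h" "s * h + t * r n dvd r n"
    using bezout_pair[OF B, of h "r n"] by blast
  define z' where "z' j = (if j < n then s * z j else t)" for j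
  have "(\<Sum>j<n. r j * z' j) = s * h"
    unfolding h_def sum_distrib_left by (rule sum.cong) (auto simp: z'_def)
  then have sum_z': "(\<Sum>j<Suc n. r j * z' j) = s * h + t * r n"
    by (simp add: z'_def mult.commute)
  have "s * h + t * r n dvd r j" if "j < Suc n" for j
  proof (cases "j = n")
    case False
    then have "h dvd r j" using z that unfolding h_def by simp
    then show ?thesis using st(1) dvd_trans by blast
  qed (use st(2) in simp)
  then show ?case unfolding sum_z'[symmetric] by (intro exI[of _ z'] allI impI)
qed

text \<open>Unimodularity of $p$ and $q$ follows from the conclusion as soon as the value $p^T A q$ is nonzero,
so the induction on rows can work with bare vectors and basis completion waits until its end.\<close>

lemma gcd_as_bilinear_value:
  fixes A :: "nat \<Rightarrow> nat \<Rightarrow> 'a::idom"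
  assumes B: "bezout_ring TYPE('a)" and G: "gelfand_range_1 TYPE('a)"
  shows "\<exists>p q. \<forall>i<m. \<forall>j<n. (\<Sum>i<m. p i * (\<Sum>j<n. A i j * q j)) dvd A i j"
proof (induction m)
  case (Suc m)
  then obtain p q where pq: "\<forall>i<m. \<forall>j<n. (\<Sum>i<m. p i * (\<Sum>j<n. A i j * q j)) dvd A i j"
    by (elim exE)
  define d where "d = (\<Sum>i<m. p i * (\<Sum>j<n. A i j * q j))"
  have d_dvd: "d dvd A i j" if "i < m" "j < n" for i j using pq that by (simp add: d_def)
  show ?case
  proof (cases "d = 0")
    case True
    obtain z where z: "\<forall>j<n. (\<Sum>j<n. A m j * z j) dvd A m j"
      using bezout_row[OF B, of n "A m"] ..
    have "(\<Sum>i<Suc m. (if i = m then 1 else 0) * (\<Sum>j<n. A i j * z j)) = (\<Sum>j<n. A m j * z j)"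
      by simp
    moreover have "\<forall>i<m. \<forall>j<n. A i j = 0" using d_dvd True by auto
    ultimately show ?thesis using z
      by (intro exI[of _ "\<lambda>i. if i = m then 1 else 0"] exI[of _ z]) (auto simp: less_Suc_eq)
  next
    case False
    \<comment> \<open>Cancelling \<open>d\<close> normalises the functional \<open>w\<close> to the value 1 at \<open>q\<close>.\<close>
    obtain M where M: "\<And>i j. i < m \<Longrightarrow> j < n \<Longrightarrow> A i j = d * M i j"
      using d_dvd unfolding dvd_def by metis
    define w where "w j = (\<Sum>i<m. p i * M i j)" for j
    have pA: "(\<Sum>i<m. p i * (\<Sum>j<n. A i j * v j)) = d * (\<Sum>j<n. w j * v j)" for v
    proof -
      have "(\<Sum>i<m. p i * (\<Sum>j<n. A i j * v j)) = (\<Sum>i<m. \<Sum>j<n. d * (p i * M i j * v j))"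
        by (simp add: sum_distrib_left M mult_ac)
      also have "\<dots> = (\<Sum>j<n. \<Sum>i<m. d * (p i * M i j * v j))" by (rule sum.swap)
      also have "\<dots> = d * (\<Sum>j<n. w j * v j)"
        by (simp add: w_def sum_distrib_left sum_distrib_right)
      finally show ?thesis .
    qed
    have wq: "(\<Sum>j<n. w j * q j) = 1" using pA[of q] False by (simp add: d_def[symmetric])
    \<comment> \<open>The new row is \<open>e * w + s\<close> with \<open>s\<close> vanishing on \<open>q\<close>, and \<open>z\<close> is shifted into the kernel
      of \<open>w\<close>. So only \<open>e\<close>, \<open>f\<close> and \<open>d\<close> matter on the span of \<open>q\<close> and \<open>z\<close>.\<close>
    define e where "e = (\<Sum>j<n. A m j * q j)"
    define s where "s j = A m j - e * w j" for j
    obtain z0 where z0: "\<forall>j<n. (\<Sum>j<n. s j * z0 j) dvd s j" using bezout_row[OF B, of n s] ..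
    define f where "f = (\<Sum>j<n. s j * z0 j)"
    define z where "z j = z0 j - (\<Sum>j<n. w j * z0 j) * q j" for j
    have sv: "(\<Sum>j<n. s j * v j) = (\<Sum>j<n. A m j * v j) - e * (\<Sum>j<n. w j * v j)" for v
      by (simp add: s_def algebra_simps sum_subtractf sum_distrib_left)
    have lin: "(\<Sum>j<n. c j * (a * v j + b * v' j)) = a * (\<Sum>j<n. c j * v j) + b * (\<Sum>j<n. c j * v' j)"
      for a b :: 'a and c v v'
      by (simp add: algebra_simps sum.distrib sum_distrib_left)
    have z_alt: "z j = 1 * z0 j + (- (\<Sum>j<n. w j * z0 j)) * q j" for j by (simp add: z_def)
    have sq: "(\<Sum>j<n. s j * q j) = 0" by (simp add: sv wq e_def[symmetric])
    have wz: "(\<Sum>j<n. w j * z j) = 0" unfolding z_alt lin wq by simp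
    have sz: "(\<Sum>j<n. s j * z j) = f" unfolding z_alt lin sq by (simp add: f_def)
    obtain x y \<alpha> \<beta> g where g: "g = x * e * \<alpha> + x * f * \<beta> + y * d * \<alpha>"
      and g_dvd: "g dvd e" "g dvd f" "g dvd d"
      using two_by_two_gcd_value[OF B G, of e f d] .
    define p1 where "p1 i = (if i < m then y * p i else x)" for i
    define q1 where "q1 j = \<alpha> * q j + \<beta> * z j" for j
    have wq1: "(\<Sum>j<n. w j * q1 j) = \<alpha>" unfolding q1_def lin wq wz by simp
    have "(\<Sum>j<n. s j * q1 j) = \<beta> * f" unfolding q1_def lin sq sz by simp
    then have Aq1: "(\<Sum>j<n. A m j * q1 j) = e * \<alpha> + \<beta> * f"
      using sv[of q1] wq1 by (simp add: algebra_simps)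
    have "(\<Sum>i<Suc m. p1 i * (\<Sum>j<n. A i j * q1 j))
        = y * (\<Sum>i<m. p i * (\<Sum>j<n. A i j * q1 j)) + x * (\<Sum>j<n. A m j * q1 j)"
      by (simp add: p1_def sum_distrib_left[of y] mult.assoc)
    also have "\<dots> = g" unfolding pA wq1 Aq1 g by (simp add: algebra_simps)
    finally have "(\<Sum>i<Suc m. p1 i * (\<Sum>j<n. A i j * q1 j)) = g" .
    moreover have "g dvd A i j" if "i < Suc m" "j < n" for i j
    proof (cases "i < m")
      case True
      then show ?thesis using d_dvd that g_dvd(3) dvd_trans by blast
    next
      case False
      have "f dvd s j" using z0 that by (simp add: f_def)
      then have "g dvd s j + e * w j" using g_dvd by (meson dvd_add dvd_mult2 dvd_trans)
      moreover have "i = m" using False that by simp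
      ultimately show ?thesis by (simp add: s_def)
    qed
    ultimately show ?thesis by (intro exI[of _ p1] exI[of _ q1]) simp
  qed
qed simp

section \<open>Invertible matrices and completion of dual pairs\<close>

lemma invertible_matI:
  fixes P P' :: "'a::semiring_1 mat"
  assumes "P \<in> carrier_mat n n" "P' \<in> carrier_mat n n" "P * P' = 1\<^sub>m n" "P' * P = 1\<^sub>m n"
  shows "invertible_mat P"
  using assms unfolding invertible_mat_def inverts_mat_def square_mat.simps by auto

lemma invertible_matE:
  assumes "invertible_mat P" "P \<in> carrier_mat n n"
  obtains P' where "P' \<in> carrier_mat n n" "P * P' = 1\<^sub>m n" "P' * P = 1\<^sub>m n"
proof -
  obtain P' where P': "P * P' = 1\<^sub>m n" "P' * P = 1\<^sub>m (dim_row P')"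
    using assms unfolding invertible_mat_def inverts_mat_def by auto
  have "dim_col P' = n" using arg_cong[OF P'(1), of dim_col] by simp
  moreover have row: "dim_row P' = n" using arg_cong[OF P'(2), of dim_col] assms(2) by simp
  ultimately have "P' \<in> carrier_mat n n" by auto
  then show thesis using P' unfolding row by (rule that)
qed

lemma mult_mat_cancel_left:
  fixes A A' X :: "'a::semiring_1 mat"
  assumes "A \<in> carrier_mat n n" "A' \<in> carrier_mat n n" "A * A' = 1\<^sub>m n" "X \<in> carrier_mat n m"
  shows "A * (A' * X) = X"
  using assoc_mult_mat[OF assms(1,2,4)] left_mult_one_mat[OF assms(4)] assms(3) by simp

lemma invertible_one_mat: "invertible_mat (1\<^sub>m n)"
  by (rule invertible_matI[of _ n "1\<^sub>m n"]) auto

lemma invertible_mult_mat: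
  fixes P Q :: "'a::semiring_1 mat"
  assumes "P \<in> carrier_mat n n" "Q \<in> carrier_mat n n" "invertible_mat P" "invertible_mat Q"
  shows "invertible_mat (P * Q)"
proof -
  obtain P' where P': "P' \<in> carrier_mat n n" "P * P' = 1\<^sub>m n" "P' * P = 1\<^sub>m n"
    using assms invertible_matE by blast
  obtain Q' where Q': "Q' \<in> carrier_mat n n" "Q * Q' = 1\<^sub>m n" "Q' * Q = 1\<^sub>m n"
    using assms invertible_matE by blast
  have "P * Q * (Q' * P') = 1\<^sub>m n"
    using assms P' Q' by (simp add: assoc_mult_mat[of _ n n _ n _ n] mult_mat_cancel_left[of _ n _ _ n])
  moreover have "Q' * P' * (P * Q) = 1\<^sub>m n"
    using assms P' Q' by (simp add: assoc_mult_mat[of _ n n _ n _ n] mult_mat_cancel_left[of _ n _ _ n])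
  ultimately show ?thesis using assms P' Q'
    by (intro invertible_matI[of _ n "Q' * P'"]) auto
qed

lemma invertible_transpose_mat:
  fixes P :: "'a::comm_semiring_1 mat"
  assumes "P \<in> carrier_mat n n" "invertible_mat P"
  shows "invertible_mat P\<^sup>T"
proof -
  obtain P' where P': "P' \<in> carrier_mat n n" "P * P' = 1\<^sub>m n" "P' * P = 1\<^sub>m n"
    using assms invertible_matE by blast
  have "P\<^sup>T * P'\<^sup>T = 1\<^sub>m n"
    unfolding transpose_mult[OF P'(1) assms(1), symmetric] P'(3) by simp
  moreover have "P'\<^sup>T * P\<^sup>T = 1\<^sub>m n"
    unfolding transpose_mult[OF assms(1) P'(1), symmetric] P'(2) by simp
  ultimately show ?thesis using assms P'
    by (intro invertible_matI[of _ n "P'\<^sup>T"]) auto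
qed

lemma invertible_upper_block_mat:
  fixes A B D :: "'a::comm_ring_1 mat"
  assumes A: "A \<in> carrier_mat k k" "invertible_mat A" and D: "D \<in> carrier_mat n n" "invertible_mat D"
    and B: "B \<in> carrier_mat k n"
  shows "invertible_mat (four_block_mat A B (0\<^sub>m n k) D)"
proof -
  obtain A' where A': "A' \<in> carrier_mat k k" "A * A' = 1\<^sub>m k" "A' * A = 1\<^sub>m k"
    using A invertible_matE by blast
  obtain D' where D': "D' \<in> carrier_mat n n" "D * D' = 1\<^sub>m n" "D' * D = 1\<^sub>m n"
    using D invertible_matE by blast
  define B' where "B' = - (A' * B * D')"
  have B': "B' \<in> carrier_mat k n" using A' B D' by (auto simp: B'_def)
  have "A * B' = - (B * D')"
    using A' A B D' unfolding B'_def
    by (simp add: assoc_mult_mat[of _ k k _ n _ n] mult_mat_cancel_left[of A k A' _ n])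
  then have 1: "A * B' + B * D' = 0\<^sub>m k n" using A' A B D' by simp
  have BD: "B' * D = - (A' * B)"
    using A' B D D' unfolding B'_def
    by (simp add: assoc_mult_mat[of _ k k _ n _ n] assoc_mult_mat[of _ k n _ n _ n])
  have 2: "A' * B + B' * D = 0\<^sub>m k n"
    unfolding BD using A' B by (intro eq_matI) auto
  show ?thesis
    by (rule invertible_matI[of _ "k + n" "four_block_mat A' B' (0\<^sub>m n k) D'"])
      (use A A' B B' D D' 1 2 in \<open>auto simp: mult_four_block_mat[of _ k k _ n _ n _ _ k _ n]\<close>)
qed

text \<open>A $2 \times 2$ block of determinant $1$, with the Bezout coefficients of two entries as first row
and their comaximal quotients, swapped and one negated, as second row, replaces the two entries by their greatest common
divisor and $0$; the induction applies it to the first entry and the reduced tail.\<close>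

lemma row_reduction_to_gcd:
  fixes u :: "'a::idom vec"
  assumes Bz: "bezout_ring TYPE('a)" and "u \<in> carrier_vec (Suc n)"
  shows "\<exists>P h. P \<in> carrier_mat (Suc n) (Suc n) \<and> invertible_mat P \<and>
    P *\<^sub>v u = h \<cdot>\<^sub>v unit_vec (Suc n) 0"
  using assms(2)
proof (induction n arbitrary: u)
  case 0
  then have "1\<^sub>m (Suc 0) *\<^sub>v u = u $ 0 \<cdot>\<^sub>v unit_vec (Suc 0) 0"
    by (intro eq_vecI) auto
  then show ?case using invertible_one_mat one_carrier_mat by blast
next
  case (Suc n)
  define u' where "u' = vec (Suc n) (\<lambda>i. u $ Suc i)"
  obtain P h where P: "P \<in> carrier_mat (Suc n) (Suc n)" "invertible_mat P"
    and Pu': "P *\<^sub>v u' = h \<cdot>\<^sub>v unit_vec (Suc n) 0"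
    using Suc.IH[of u'] by (auto simp: u'_def)
  obtain g a b where g: "u $ 0 = g * a" "h = g * b" "comaximal a b"
    by (rule hermite_pair[OF Bz])
  obtain s t where st: "s * a + t * b = 1" using g(3) by (auto simp: comaximal_def)
  define U where "U = mat_of_rows_list 2 [[s, t], [- b, a]]"
  define U' where "U' = mat_of_rows_list 2 [[a, - t], [b, s]]"
  have U_carrier: "U \<in> carrier_mat 2 2" "U' \<in> carrier_mat 2 2"
    by (auto simp: U_def U'_def mat_of_rows_list_def)
  have "U * U' = 1\<^sub>m 2" "U' * U = 1\<^sub>m 2" using st
    by (auto intro!: eq_matI simp: U_def U'_def mat_of_rows_list_def scalar_prod_def less_2_cases_iff
        algebra_simps)
  then have U: "invertible_mat U" using U_carrier by (intro invertible_matI[of _ 2 U']) auto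
  have Uv: "U *\<^sub>v vec 2 (\<lambda>i. if i = 0 then u $ 0 else h) = vec 2 (\<lambda>i. if i = 0 then g else 0)"
  proof -
    have "s * (g * a) + t * (g * b) = g * (s * a + t * b)" by (simp add: algebra_simps)
    then have "s * u $ 0 + t * h = g" using st g by simp
    moreover have "a * h = b * u $ 0" using g by (simp add: mult_ac)
    ultimately show ?thesis
      by (auto intro!: eq_vecI simp: U_def mat_of_rows_list_def scalar_prod_def less_2_cases_iff
          numeral_2_eq_2)
  qed
  define P1 where "P1 = four_block_mat (1\<^sub>m 1) (0\<^sub>m 1 (Suc n)) (0\<^sub>m (Suc n) 1) P"
  define P2 where "P2 = four_block_mat U (0\<^sub>m 2 n) (0\<^sub>m n 2) (1\<^sub>m n)"
  have P1: "P1 \<in> carrier_mat (Suc (Suc n)) (Suc (Suc n))" "invertible_mat P1"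
    using P invertible_upper_block_mat[OF one_carrier_mat invertible_one_mat P(1,2), of "0\<^sub>m 1 (Suc n)" 1]
    by (auto simp: P1_def)
  have P2: "P2 \<in> carrier_mat (Suc (Suc n)) (Suc (Suc n))" "invertible_mat P2"
    using U_carrier invertible_upper_block_mat[OF U_carrier(1) U one_carrier_mat invertible_one_mat, of "0\<^sub>m 2 n"]
    by (auto simp: P2_def)
  have "u = vec 1 (\<lambda>_. u $ 0) @\<^sub>v u'"
    using Suc.prems by (intro eq_vecI) (auto simp: u'_def)
  then have "P1 *\<^sub>v u = vec 1 (\<lambda>_. u $ 0) @\<^sub>v P *\<^sub>v u'"
    using P unfolding P1_def by (metis mult_mat_vec_split one_carrier_mat one_mult_mat_vec u'_def vec_carrier)
  also have "\<dots> = vec 2 (\<lambda>i. if i = 0 then u $ 0 else h) @\<^sub>v 0\<^sub>v n"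
    unfolding Pu' by (intro eq_vecI) (auto simp: numeral_2_eq_2)
  finally have "P2 *\<^sub>v (P1 *\<^sub>v u) = vec 2 (\<lambda>i. if i = 0 then g else 0) @\<^sub>v 0\<^sub>v n"
    unfolding P2_def using U_carrier
    by (simp add: mult_mat_vec_split[OF U_carrier(1) one_carrier_mat] Uv)
  also have "\<dots> = g \<cdot>\<^sub>v unit_vec (Suc (Suc n)) 0"
    by (intro eq_vecI) auto
  finally have "P2 * P1 *\<^sub>v u = g \<cdot>\<^sub>v unit_vec (Suc (Suc n)) 0"
    using P1 P2 Suc.prems by simp
  then show ?case using P1 P2 invertible_mult_mat mult_carrier_mat by blast
qed

lemma row_mult_mat:
  fixes A B :: "'a::comm_semiring_0 mat"
  assumes "A \<in> carrier_mat l m" "B \<in> carrier_mat m n" "i < l"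
  shows "row (A * B) i = B\<^sup>T *\<^sub>v row A i"
  using assms by (intro eq_vecI) (auto intro!: comm_scalar_prod[of _ m])

lemma col_mult_mat:
  fixes A B :: "'a::semiring_0 mat"
  assumes "A \<in> carrier_mat l m" "B \<in> carrier_mat m n" "j < n"
  shows "col (A * B) j = A *\<^sub>v col B j"
  using assms by (intro eq_vecI) auto

text \<open>If $R$ reduces $u$ to $h e_1$, then $p$ becomes a functional $r$ with $r_0 h = 1$, so $r_0$ is a
unit and the identity matrix with first row replaced by $r$ is invertible. It sends $h e_1$ to
$e_1$, hence its product with $R$ has the required properties.\<close>

lemma dual_pair_completion:
  fixes p u :: "'a::idom vec"
  assumes Bz: "bezout_ring TYPE('a)"
    and p: "p \<in> carrier_vec (Suc n)" and u: "u \<in> carrier_vec (Suc n)" and pu: "p \<bullet> u = 1"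
  shows "\<exists>P. P \<in> carrier_mat (Suc n) (Suc n) \<and> invertible_mat P \<and>
    row P 0 = p \<and> P *\<^sub>v u = unit_vec (Suc n) 0"
proof -
  let ?n = "Suc n"
  obtain R h where R: "R \<in> carrier_mat ?n ?n" "invertible_mat R"
    and Ru: "R *\<^sub>v u = h \<cdot>\<^sub>v unit_vec ?n 0"
    using row_reduction_to_gcd[OF Bz u] by blast
  obtain R' where R': "R' \<in> carrier_mat ?n ?n" "R * R' = 1\<^sub>m ?n" "R' * R = 1\<^sub>m ?n"
    using R invertible_matE by blast
  define r where "r = R'\<^sup>T *\<^sub>v p"
  have r: "r \<in> carrier_vec ?n" using R' p by (auto simp: r_def)
  have "R\<^sup>T *\<^sub>v r = (R' * R)\<^sup>T *\<^sub>v p"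
    using R R' p unfolding r_def transpose_mult[OF R'(1) R(1)]
    by (intro assoc_mult_mat_vec[symmetric, of _ ?n ?n _ ?n]) auto
  then have Rr: "R\<^sup>T *\<^sub>v r = p" using R' p by simp
  have "p \<bullet> u = r \<bullet> (R *\<^sub>v u)"
    unfolding Rr[symmetric] using R r u by (metis transpose_vec_mult_scalar)
  then have rh: "r $ 0 * h = 1" using pu r unfolding Ru by (simp add: mult.commute)
  define E where "E = four_block_mat (mat 1 1 (\<lambda>_. r $ 0)) (mat 1 n (\<lambda>(i, j). r $ Suc j))
    (0\<^sub>m n 1) (1\<^sub>m n)"
  have "invertible_mat (mat 1 1 (\<lambda>_. r $ 0))"
    by (rule invertible_matI[of _ 1 "mat 1 1 (\<lambda>_. h)"])
      (use rh in \<open>auto intro!: eq_matI simp: scalar_prod_def mult.commute\<close>)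
  then have E: "E \<in> carrier_mat ?n ?n" "invertible_mat E"
    unfolding E_def by (auto intro!: invertible_upper_block_mat invertible_one_mat)
  have row_E: "row E 0 = r"
    using r by (intro eq_vecI) (auto simp: E_def)
  have "E *\<^sub>v (h \<cdot>\<^sub>v unit_vec ?n 0) = unit_vec ?n 0"
  proof (intro eq_vecI)
    fix i assume "i < dim_vec (unit_vec ?n 0 :: 'a vec)"
    then have "i < ?n" by simp
    then have "(E *\<^sub>v (h \<cdot>\<^sub>v unit_vec ?n 0)) $ i = h * E $$ (i, 0)" using E by auto
    also have "\<dots> = unit_vec ?n 0 $ i"
      using \<open>i < ?n\<close> rh by (auto simp: E_def mult.commute)
    finally show "(E *\<^sub>v (h \<cdot>\<^sub>v unit_vec ?n 0)) $ i = unit_vec ?n 0 $ i" .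
  qed (use E in auto)
  then have "E * R *\<^sub>v u = unit_vec ?n 0" using E R u Ru by simp
  moreover have "row (E * R) 0 = p" using row_mult_mat[OF E(1) R(1), of 0] row_E Rr by simp
  moreover have "invertible_mat (E * R)" "E * R \<in> carrier_mat ?n ?n"
    using E R invertible_mult_mat by auto
  ultimately show ?thesis by blast
qed

section \<open>Diagonal reduction\<close>

text \<open>Write $A = g A_1$ with $g = p^T A q$. The first row of the base change on the left is $p$ and the first column of the one on the right is
$q$. As the former sends $A_1 q$ to $e_1$ and the transpose of the latter sends $A_1^T p$ to $e_1$,
the first row and column of the transformed $A_1$ are those of the identity matrix. The
complement $A'$ carries the factor $g$ because all of $A$ does.\<close>

lemma split_off_gcd:
  fixes A :: "'a::idom mat"
  assumes Bz: "bezout_ring TYPE('a)" and G: "gelfand_range_1 TYPE('a)"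
    and A: "A \<in> carrier_mat (Suc m) (Suc n)"
  shows "\<exists>P Q g A'. P \<in> carrier_mat (Suc m) (Suc m) \<and> invertible_mat P \<and>
    Q \<in> carrier_mat (Suc n) (Suc n) \<and> invertible_mat Q \<and> A' \<in> carrier_mat m n \<and>
    P * A * Q = four_block_mat (mat 1 1 (\<lambda>_. g)) (0\<^sub>m 1 n) (0\<^sub>m m 1) (g \<cdot>\<^sub>m A')"
proof -
  obtain p q where pq: "\<forall>i<Suc m. \<forall>j<Suc n.
      (\<Sum>i<Suc m. p i * (\<Sum>j<Suc n. A $$ (i, j) * q j)) dvd A $$ (i, j)"
    using gcd_as_bilinear_value[OF Bz G, of "Suc m" "Suc n" "\<lambda>i j. A $$ (i, j)"]
    by (elim exE)
  define pv where "pv = vec (Suc m) p"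
  define qv where "qv = vec (Suc n) q"
  have pv: "pv \<in> carrier_vec (Suc m)" and qv: "qv \<in> carrier_vec (Suc n)"
    by (auto simp: pv_def qv_def)
  define g where "g = pv \<bullet> (A *\<^sub>v qv)"
  have "g = (\<Sum>i<Suc m. p i * (\<Sum>j<Suc n. A $$ (i, j) * q j))"
    using A unfolding g_def scalar_prod_def
    by (auto simp: pv_def qv_def scalar_prod_def lessThan_atLeast0 simp del: sum.op_ivl_Suc intro!: sum.cong)
  then have g_dvd: "g dvd A $$ (i, j)" if "i < Suc m" "j < Suc n" for i j
    using pq that by metis
  then obtain a1 where a1: "\<And>i j. i < Suc m \<Longrightarrow> j < Suc n \<Longrightarrow> A $$ (i, j) = g * a1 i j"
    unfolding dvd_def by metis
  define A1 where "A1 = mat (Suc m) (Suc n) (\<lambda>(i, j). a1 i j)"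
  have A1: "A1 \<in> carrier_mat (Suc m) (Suc n)" by (simp add: A1_def)
  have A_A1: "A = g \<cdot>\<^sub>m A1" using A a1 by (intro eq_matI) (auto simp: A1_def)
  show ?thesis
  proof (cases "g = 0")
    case True
    then have "A = 0\<^sub>m (Suc m) (Suc n)" unfolding A_A1 using A1 by (intro eq_matI) auto
    then have "1\<^sub>m (Suc m) * A * 1\<^sub>m (Suc n)
        = four_block_mat (mat 1 1 (\<lambda>_. 0)) (0\<^sub>m 1 n) (0\<^sub>m m 1) (0 \<cdot>\<^sub>m 0\<^sub>m m n)"
      by (intro eq_matI) auto
    then show ?thesis using invertible_one_mat one_carrier_mat zero_carrier_mat by metis
  next
    case False
    define u where "u = A1 *\<^sub>v qv"
    define w where "w = A1\<^sup>T *\<^sub>v pv"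
    have u: "u \<in> carrier_vec (Suc m)" and w: "w \<in> carrier_vec (Suc n)"
      using A1 pv qv by (auto simp: u_def w_def)
    have "A *\<^sub>v qv = g \<cdot>\<^sub>v u" unfolding A_A1 u_def using A1 qv
      by (intro eq_vecI) auto
    then have "pv \<bullet> (g \<cdot>\<^sub>v u) = g" by (simp add: g_def)
    then have "g * (pv \<bullet> u) = g * 1" using pv u by simp
    then have pu: "pv \<bullet> u = 1" using False mult_left_cancel by blast
    have "w \<bullet> qv = pv \<bullet> u"
      unfolding u_def w_def by (rule transpose_vec_mult_scalar[OF A1 qv pv])
    then have qw: "qv \<bullet> w = 1" using pu comm_scalar_prod[OF qv w] by simp
    obtain P where P: "P \<in> carrier_mat (Suc m) (Suc m)" "invertible_mat P"
      "row P 0 = pv" "P *\<^sub>v u = unit_vec (Suc m) 0"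
      using dual_pair_completion[OF Bz pv u pu] by blast
    obtain T where T: "T \<in> carrier_mat (Suc n) (Suc n)" "invertible_mat T"
      "row T 0 = qv" "T *\<^sub>v w = unit_vec (Suc n) 0"
      using dual_pair_completion[OF Bz qv w qw] by blast
    define Q where "Q = T\<^sup>T"
    have Q: "Q \<in> carrier_mat (Suc n) (Suc n)" "invertible_mat Q" "col Q 0 = qv"
      using T invertible_transpose_mat by (auto simp: Q_def)
    define M where "M = P * A1 * Q"
    have M: "M \<in> carrier_mat (Suc m) (Suc n)" using P Q A1 by (auto simp: M_def)
    have "col M 0 = P * A1 *\<^sub>v qv"
      using col_mult_mat[of "P * A1" "Suc m" "Suc n" Q "Suc n" 0] P A1 Q by (simp add: M_def)
    then have col_M: "col M 0 = unit_vec (Suc m) 0"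
      using P assoc_mult_mat_vec[OF P(1) A1 qv] by (simp add: u_def)
    have "row M 0 = T *\<^sub>v (A1\<^sup>T *\<^sub>v row P 0)"
      unfolding M_def using row_mult_mat[of "P * A1" "Suc m" "Suc n" Q "Suc n" 0]
        row_mult_mat[OF P(1) A1, of 0] P A1 Q by (simp add: Q_def)
    then have row_M: "row M 0 = unit_vec (Suc n) 0" using P(3) T(4) by (simp add: w_def)
    define A' where "A' = mat m n (\<lambda>(i, j). M $$ (Suc i, Suc j))"
    have M0: "M $$ (i, 0) = (if i = 0 then 1 else 0)" if "i < Suc m" for i
      using arg_cong[OF col_M, of "\<lambda>v. v $ i"] M that by simp
    have M0': "M $$ (0, j) = (if j = 0 then 1 else 0)" if "j < Suc n" for j
      using arg_cong[OF row_M, of "\<lambda>v. v $ j"] M that by simp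
    have "P * A * Q = g \<cdot>\<^sub>m M"
      unfolding A_A1 M_def using P A1 Q
      by (simp add: mult_smult_distrib[of _ _ "Suc m"] mult_smult_assoc_mat[of _ "Suc m" "Suc n"])
    also have "\<dots> = four_block_mat (mat 1 1 (\<lambda>_. g)) (0\<^sub>m 1 n) (0\<^sub>m m 1) (g \<cdot>\<^sub>m A')"
      using M by (intro eq_matI) (auto simp: A'_def M0 M0')
    finally show ?thesis using P Q by (metis A'_def mat_carrier)
  qed
qed

text \<open>The induction reduces $A'$ and not $gA'$: the scalar $g$ commutes with the base changes, and so
divides all later diagonal entries without a further invariant.\<close>

lemma diagonalization:
  fixes A :: "'a::idom mat"
  assumes Bz: "bezout_ring TYPE('a)" and G: "gelfand_range_1 TYPE('a)"
    and "A \<in> carrier_mat m n"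
  shows "\<exists>P Q. P \<in> carrier_mat m m \<and> invertible_mat P \<and> Q \<in> carrier_mat n n \<and> invertible_mat Q \<and>
    diagonal_mat (P * A * Q) \<and>
    (\<forall>i. i + 1 < min m n \<longrightarrow> (P * A * Q) $$ (i, i) dvd (P * A * Q) $$ (i + 1, i + 1))"
  using assms(3)
proof (induction m arbitrary: n A)
  case 0
  then show ?case
    by (intro exI[of _ "1\<^sub>m 0"] exI[of _ "1\<^sub>m n"]) (auto simp: invertible_one_mat diagonal_mat_def)
next
  case (Suc m n)
  show ?case
  proof (cases n)
    case 0
    then show ?thesis using Suc.prems
      by (intro exI[of _ "1\<^sub>m (Suc m)"] exI[of _ "1\<^sub>m 0"]) (auto simp: invertible_one_mat diagonal_mat_def)
  next
    case n: (Suc k)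
    obtain P Q g A' where P: "P \<in> carrier_mat (Suc m) (Suc m)" "invertible_mat P"
      and Q: "Q \<in> carrier_mat (Suc k) (Suc k)" "invertible_mat Q"
      and A': "A' \<in> carrier_mat m k"
      and PAQ: "P * A * Q = four_block_mat (mat 1 1 (\<lambda>_. g)) (0\<^sub>m 1 k) (0\<^sub>m m 1) (g \<cdot>\<^sub>m A')"
      using split_off_gcd[OF Bz G Suc.prems[unfolded n]] by (elim exE conjE)
    obtain P' Q' where P': "P' \<in> carrier_mat m m" "invertible_mat P'"
      and Q': "Q' \<in> carrier_mat k k" "invertible_mat Q'"
      and diag: "diagonal_mat (P' * A' * Q')"
      and chain: "\<And>i. i + 1 < min m k \<Longrightarrow>
        (P' * A' * Q') $$ (i, i) dvd (P' * A' * Q') $$ (i + 1, i + 1)"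
      using Suc.IH[OF A'] by blast
    define D where "D = P' * A' * Q'"
    have D: "D \<in> carrier_mat m k" using P' A' Q' by (auto simp: D_def)
    define P1 where "P1 = four_block_mat (1\<^sub>m 1) (0\<^sub>m 1 m) (0\<^sub>m m 1) P'"
    define Q1 where "Q1 = four_block_mat (1\<^sub>m 1) (0\<^sub>m 1 k) (0\<^sub>m k 1) Q'"
    have P1: "P1 \<in> carrier_mat (Suc m) (Suc m)" "invertible_mat P1"
      using P' invertible_upper_block_mat[OF one_carrier_mat invertible_one_mat P', of "0\<^sub>m 1 m" 1]
      by (auto simp: P1_def)
    have Q1: "Q1 \<in> carrier_mat (Suc k) (Suc k)" "invertible_mat Q1"
      using Q' invertible_upper_block_mat[OF one_carrier_mat invertible_one_mat Q', of "0\<^sub>m 1 k" 1]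
      by (auto simp: Q1_def)
    define E where "E = four_block_mat (mat 1 1 (\<lambda>_. g)) (0\<^sub>m 1 k) (0\<^sub>m m 1) (g \<cdot>\<^sub>m D)"
    have smult_D: "P' * (g \<cdot>\<^sub>m A') * Q' = g \<cdot>\<^sub>m D"
      using P' A' Q' unfolding D_def
      by (simp add: mult_smult_distrib[of _ _ m] mult_smult_assoc_mat[of _ m k])
    have "P1 * P * A * (Q * Q1) = P1 * (P * A * Q) * Q1"
      using P1 P Q Q1 Suc.prems n by (simp add: assoc_mult_mat[of _ "Suc m" "Suc m" _ "Suc k" _ "Suc k"]
        assoc_mult_mat[of _ "Suc m" "Suc m" _ "Suc m" _ "Suc k"]
        assoc_mult_mat[of _ "Suc m" "Suc k" _ "Suc k" _ "Suc k"])
    also have "\<dots> = E"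
    proof -
      have left: "P1 * (P * A * Q) = four_block_mat (mat 1 1 (\<lambda>_. g)) (0\<^sub>m 1 k) (0\<^sub>m m 1) (P' * (g \<cdot>\<^sub>m A'))"
        unfolding P1_def PAQ using P' A'
        by (subst mult_four_block_mat[of _ 1 1 _ m _ m _ _ 1 _ k]) auto
      show ?thesis unfolding left Q1_def E_def smult_D[symmetric] using P' A' Q'
        by (subst mult_four_block_mat[of _ 1 1 _ k _ m _ _ 1 _ k]) auto
    qed
    finally have eq: "P1 * P * A * (Q * Q1) = E" .
    have E_Suc: "E $$ (Suc i, Suc j) = g * D $$ (i, j)" if "i < m" "j < k" for i j
      using D that by (auto simp: E_def)
    have "diagonal_mat E"
      unfolding diagonal_mat_def
    proof (intro allI impI)
      fix i j assume "i < dim_row E" "j < dim_col E" "i \<noteq> j"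
      then show "E $$ (i, j) = 0"
        using D diag unfolding diagonal_mat_def D_def[symmetric]
        by (cases i; cases j) (auto simp: E_def)
    qed
    moreover have "E $$ (i, i) dvd E $$ (i + 1, i + 1)" if "i + 1 < min (Suc m) (Suc k)" for i
    proof (cases i)
      case 0
      then show ?thesis using D that by (auto simp: E_def)
    next
      case (Suc l)
      then have "D $$ (l, l) dvd D $$ (l + 1, l + 1)" using chain[of l] that by (simp add: D_def)
      then show ?thesis using E_Suc[of l l] E_Suc[of "Suc l" "Suc l"] Suc that
        by (simp add: mult_dvd_mono)
    qed
    moreover have "invertible_mat (P1 * P)" "P1 * P \<in> carrier_mat (Suc m) (Suc m)"
      "invertible_mat (Q * Q1)" "Q * Q1 \<in> carrier_mat (Suc k) (Suc k)"
      using P P1 Q Q1 invertible_mult_mat by auto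
    ultimately show ?thesis unfolding n
      by (intro exI[of _ "P1 * P"] exI[of _ "Q * Q1"]) (simp add: eq)
  qed
qed

theorem theorem3:
  assumes "bezout_ring TYPE('a::idom)"
    and "gelfand_range_1 TYPE('a)"
  shows "elementary_divisor_ring TYPE('a)"
  unfolding elementary_divisor_ring_def
proof
  fix A :: "'a mat"
  show "\<exists>P Q D. P \<in> carrier_mat (dim_row A) (dim_row A) \<and> invertible_mat P \<and>
    Q \<in> carrier_mat (dim_col A) (dim_col A) \<and> invertible_mat Q \<and> D = P * A * Q \<and> diagonal_mat D \<and>
    (\<forall>i. i + 1 < min (dim_row A) (dim_col A) \<longrightarrow> D $$ (i, i) dvd D $$ (i + 1, i + 1))"
    using diagonalization[OF assms, of A "dim_row A" "dim_col A"] by blast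
qed

end
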